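(* Let $f$ be a germ function, and let $b$ and $\alpha_j$ ($j\in J$) be continuous functions such that $$|f(x)-f(y)|\le k_f|x-y|^{s},\qquad |b(x)-b(y)|\le k_b|x-y|^{s},\qquad |\alpha_j(x)-\alpha_j(y)|\le k_\alpha|x-y|^{s}$$ for every $x,y\in I$, $j\in J$, and for some $k_f,k_b,k_\alpha>0$, $s\in(0,1]$. Further, assume that there are constants $K_f,\delta_0>0$ such that for each $x\in I$ and $\delta<\delta_0$ there exists $y\in I$ with $|x-y|\le\delta$ and $|f(x)-f(y)|\ge K_f|x-y|^{s}$. Let $k_{f^\alpha}>0$ be a constant with $|f^\alpha(x)-f^\alpha(y)|\le k_{f^\alpha}|x-y|^s$ for all $x,y\in I$. Then $$\dim_B\big(\mathrm{Graph}(f^{\alpha})\big)=2-s$$ provided that $$\|\alpha\|_{\mathcal{H}}<a^{s}\,\min\Big\{1,\ \frac{K_f-(\|b\|_\infty+M)\,k_\alpha\,a^{-s}}{k_{f^\alpha}+k_b}\Big\}.$$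
   Context: Let $\Delta=\{x_1<x_2<\dots<x_N\}$ be a partition of $I=[x_1,x_N]\subset\mathbb{R}$, $J=\{1,\dots,N-1\}$, $I_j=[x_j,x_{j+1}]$ for $j\in J$. For $j\in J$ let $L_j:I\to I_j$, $L_j(x)=a_jx+b_j$, be the affine contraction homeomorphism with $L_j(x_1)=x_j$, $L_j(x_N)=x_{j+1}$, and put $a:=\min\{a_j:j\in J\}$. Let $f:I\to\mathbb{R}$ be continuous (germ function); let $b:I\to\mathbb{R}$ be continuous with $b(x_1)=f(x_1)$, $b(x_N)=f(x_N)$, $b\neq f$ (base function); let $\alpha=(\alpha_1,\dots,\alpha_{N-1})$ with each $\alpha_j:I\to\mathbb{R}$ continuous and $\|\alpha\|_\infty:=\max_{j\in J}\|\alpha_j\|_\infty<1$ (scaling functions), where $\|\cdot\|_\infty$ is the sup norm on $I$. The $\alpha$-fractal function $f^\alpha:I\to\mathbb{R}$ corresponding to $f$ with respect to $\Delta$ and $b$ is the unique continuous function satisfying $$f^{\alpha}(x)=f(x)+\alpha_j(L_j^{-1}(x))\,(f^{\alpha}-b)(L_j^{-1}(x))\quad\text{for all }x\in I_j,\ j\in J.$$ Put $M:=\|f\|_\infty+\frac{\|\alpha\|_\infty}{1-\|\alpha\|_\infty}\|f-b\|_\infty$, and $$\|\alpha\|_{\mathcal{H}}:=\|\alpha\|_\infty+[\alpha]_s,\qquad [\alpha]_s:=\max_{j\in J}\ \sup_{x\neq y,\ x,y\in I}\frac{|\alpha_j(x)-\alpha_j(y)|}{|x-y|^{s}}.$$ $\mathrm{Graph}(f^\alpha)=\{(x,f^\alpha(x)):x\in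 I\}$ and $\dim_B$ denotes box dimension (the common value of the lower and upper box dimensions).
   Formalization: The oscillation hypothesis is read as |f(x)-f(y)| ≥ K_f δ^s (with 0<δ<δ_0) instead of K_f|x-y|^s; as printed, y=x satisfies it for every f and the claim fails, e.g. f(x)=x, b(x)=x^2, α=0, s=1/2, K_f=100. *)

theory Defs
  imports "HOL-Analysis.Analysis"
begin

text \<open>A partition is a function \<open>p :: nat \<Rightarrow> real\<close> of which only the values
  \<open>p 1 < \<dots> < p N\<close> matter. Functions on the interval \<open>I = {p 1..p N}\<close> are total functions on
  the reals that are only ever evaluated on \<open>I\<close>.\<close>

definition piece_slope :: "nat \<Rightarrow> (nat \<Rightarrow> real) \<Rightarrow> nat \<Rightarrow> real" where
  "piece_slope N p j = (p (j + 1) - p j) / (p N - p 1)"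

definition piece_offset :: "nat \<Rightarrow> (nat \<Rightarrow> real) \<Rightarrow> nat \<Rightarrow> real" where
  "piece_offset N p j = (p N * p j - p 1 * p (j + 1)) / (p N - p 1)"

definition piece_map :: "nat \<Rightarrow> (nat \<Rightarrow> real) \<Rightarrow> nat \<Rightarrow> real \<Rightarrow> real" where
  "piece_map N p j t = piece_slope N p j * t + piece_offset N p j"

lemma piece_map_endpoints:
  assumes "p 1 < p N"
  shows "piece_map N p j (p 1) = p j" and "piece_map N p j (p N) = p (j + 1)"
  using assms
  by (simp_all add: piece_map_def piece_slope_def piece_offset_def divide_simps)
    (simp_all add: algebra_simps)

definition min_slope :: "nat \<Rightarrow> (nat \<Rightarrow> real) \<Rightarrow> real" where
  "min_slope N p = Min (piece_slope N p ` {1..N - 1})"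

definition is_fractal_function ::
    "nat \<Rightarrow> (nat \<Rightarrow> real) \<Rightarrow> (real \<Rightarrow> real) \<Rightarrow> (real \<Rightarrow> real) \<Rightarrow> (nat \<Rightarrow> real \<Rightarrow> real) \<Rightarrow>
      (real \<Rightarrow> real) \<Rightarrow> bool" where
  "is_fractal_function N p f b \<alpha> g \<longleftrightarrow>
     continuous_on {p 1..p N} g \<and>
     (\<forall>j\<in>{1..N - 1}. \<forall>t\<in>{p j..p (j + 1)}.
        let u = the_inv_into {p 1..p N} (piece_map N p j) t
        in g t = f t + \<alpha> j u * (g u - b u))"

definition sup_norm :: "real set \<Rightarrow> (real \<Rightarrow> real) \<Rightarrow> real" where
  "sup_norm I f = (SUP t\<in>I. \<bar>f t\<bar>)"

definition scaling_sup_norm :: "nat \<Rightarrow> (nat \<Rightarrow> real) \<Rightarrow> (nat \<Rightarrow> real \<Rightarrow> real) \<Rightarrow> real" where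
  "scaling_sup_norm N p \<alpha> = (MAX j\<in>{1..N - 1}. sup_norm {p 1..p N} (\<alpha> j))"

definition scaling_seminorm ::
    "nat \<Rightarrow> (nat \<Rightarrow> real) \<Rightarrow> real \<Rightarrow> (nat \<Rightarrow> real \<Rightarrow> real) \<Rightarrow> real" where
  "scaling_seminorm N p s \<alpha> =
     (MAX j\<in>{1..N - 1}.
        Sup {\<bar>\<alpha> j t - \<alpha> j u\<bar> / \<bar>t - u\<bar> powr s | t u.
              t \<in> {p 1..p N} \<and> u \<in> {p 1..p N} \<and> t \<noteq> u})"

definition scaling_holder_norm ::
    "nat \<Rightarrow> (nat \<Rightarrow> real) \<Rightarrow> real \<Rightarrow> (nat \<Rightarrow> real \<Rightarrow> real) \<Rightarrow> real" where
  "scaling_holder_norm N p s \<alpha> = scaling_sup_norm N p \<alpha> + scaling_seminorm N p s \<alpha>"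

definition fractal_bound ::
    "nat \<Rightarrow> (nat \<Rightarrow> real) \<Rightarrow> (real \<Rightarrow> real) \<Rightarrow> (real \<Rightarrow> real) \<Rightarrow> (nat \<Rightarrow> real \<Rightarrow> real) \<Rightarrow> real" where
  "fractal_bound N p f b \<alpha> =
     sup_norm {p 1..p N} f +
     scaling_sup_norm N p \<alpha> / (1 - scaling_sup_norm N p \<alpha>) *
       sup_norm {p 1..p N} (\<lambda>t. f t - b t)"

definition holder_on :: "real set \<Rightarrow> real \<Rightarrow> real \<Rightarrow> (real \<Rightarrow> real) \<Rightarrow> bool" where
  "holder_on I s k f \<longleftrightarrow> (\<forall>t\<in>I. \<forall>u\<in>I. \<bar>f t - f u\<bar> \<le> k * \<bar>t - u\<bar> powr s)"

definition graph_on :: "real set \<Rightarrow> (real \<Rightarrow> real) \<Rightarrow> (real \<times> real) set" where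
  "graph_on I f = {(t, f t) | t. t \<in> I}"

text \<open>The least number of sets of diameter at most \<open>\<delta>\<close> covering \<open>F\<close>, meaningful for totally
  bounded \<open>F\<close>. Boundedness of the covering sets is required because the library's
  \<open>diameter\<close> is unspecified on unbounded sets.\<close>

definition covering_number :: "'a::metric_space set \<Rightarrow> real \<Rightarrow> nat" where
  "covering_number F \<delta> =
     (LEAST n. \<exists>C. finite C \<and> card C = n \<and> F \<subseteq> \<Union>C \<and> (\<forall>U\<in>C. bounded U \<and> diameter U \<le> \<delta>))"

definition lower_box_dim :: "'a::metric_space set \<Rightarrow> ereal" where
  "lower_box_dim F =
     Liminf (at_right 0) (\<lambda>\<delta>. ereal (ln (real (covering_number F \<delta>)) / - ln \<delta>))"

definition upper_box_dim :: "'a::metric_space set \<Rightarrow> ereal" where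
  "upper_box_dim F =
     Limsup (at_right 0) (\<lambda>\<delta>. ereal (ln (real (covering_number F \<delta>)) / - ln \<delta>))"

definition has_box_dim :: "'a::metric_space set \<Rightarrow> real \<Rightarrow> bool" where
  "has_box_dim F d \<longleftrightarrow> lower_box_dim F = ereal d \<and> upper_box_dim F = ereal d"

text \<open>The lower oscillation condition in its standard form, with \<open>\<delta> powr s\<close> on the right-hand
  side. With \<open>\<bar>t - u\<bar> powr s\<close> instead, the choice \<open>u = t\<close> would make the condition hold for
  every \<open>f\<close>.\<close>

definition oscillates_on :: "real set \<Rightarrow> real \<Rightarrow> real \<Rightarrow> real \<Rightarrow> (real \<Rightarrow> real) \<Rightarrow> bool" where
  "oscillates_on I s K \<delta>0 f \<longleftrightarrow>
     (\<forall>t\<in>I. \<forall>\<delta>. 0 < \<delta> \<and> \<delta> < \<delta>0 \<longrightarrow>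
        (\<exists>u\<in>I. \<bar>t - u\<bar> \<le> \<delta> \<and> \<bar>f t - f u\<bar> \<ge> K * \<delta> powr s))"

end

theory Submission
  imports Defs
begin

text \<open>
  The exponent \<open>2 - s\<close> reflects that, over a column of width \<open>\<delta>\<close>, the graph of \<open>f\<^sup>\<alpha>\<close> has
  height comparable to \<open>\<delta> powr s\<close>: such a column needs about \<open>\<delta> powr (s - 1)\<close> sets of diameter
  \<open>\<delta>\<close>, and there are about \<open>1 / \<delta>\<close> columns. Covering numbers of order \<open>\<delta> powr (s - 2)\<close> give
  the dimension by \<open>has_box_dim_if_covering_number_bounds\<close>.

  The upper estimate holds for every Holder function (\<open>holder_covering_number_le\<close>).
  For the lower estimate, the self-referential equation on a piece expresses an increment of
  \<open>f\<^sup>\<alpha>\<close> as the increment of \<open>f\<close> plus the increment of \<open>\<alpha>\<^sub>j (f\<^sup>\<alpha> - b)\<close> between points whose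
  distance has grown by at most the factor \<open>1 / a\<close>. The second increment is at most
  \<open>(\<parallel>\<alpha>\<parallel> (k_f\<alpha> + k_b) + (\<parallel>b\<parallel> + M) k_\<alpha>) a powr (- s) \<delta> powr s\<close>, and the bound assumed on
  the Holder norm of \<open>\<alpha>\<close> says that this coefficient is smaller than \<open>K_f\<close>. So \<open>f\<^sup>\<alpha>\<close> inherits
  the oscillation of \<open>f\<close> (\<open>fractal_function_oscillation\<close>). Since \<open>f\<^sup>\<alpha>\<close> is continuous, its
  graph passes through all heights in each column, and one can choose on it \<open>\<delta>\<close>-separated points
  in number of order \<open>\<delta> powr (s - 2)\<close> (\<open>oscillating_covering_number_ge\<close>). As only a lower bound is
  wanted, it suffices to do this over the first piece of the partition.
\<close>

section \<open>Covering numbers and box dimension\<close>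

lemma covering_number_attained:
  assumes "finite C" "F \<subseteq> \<Union>C" "\<forall>U\<in>C. bounded U \<and> diameter U \<le> \<delta>"
  shows "\<exists>D. finite D \<and> card D = covering_number F \<delta> \<and> F \<subseteq> \<Union>D \<and>
             (\<forall>U\<in>D. bounded U \<and> diameter U \<le> \<delta>)"
  unfolding covering_number_def
  by (rule LeastI_ex) (use assms in blast)

lemma covering_number_le_card:
  assumes "finite C" "F \<subseteq> \<Union>C" "\<forall>U\<in>C. bounded U \<and> diameter U \<le> \<delta>"
  shows "covering_number F \<delta> \<le> card C"
  unfolding covering_number_def
  by (rule Least_le) (use assms in blast)

text \<open>A set of diameter at most \<open>\<delta>\<close> contains at most one point of a \<open>\<delta>\<close>-separated set. The
  finite cover \<open>C\<close> only serves to make the covering number meaningful.\<close>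

lemma card_separated_le_covering_number:
  assumes "finite C" "F \<subseteq> \<Union>C" "\<forall>U\<in>C. bounded U \<and> diameter U \<le> \<delta>"
    and "P \<subseteq> F" and separated: "\<And>x y. x \<in> P \<Longrightarrow> y \<in> P \<Longrightarrow> x \<noteq> y \<Longrightarrow> \<delta> < dist x y"
  shows "card P \<le> covering_number F \<delta>"
proof -
  obtain D where D: "finite D" "card D = covering_number F \<delta>" "F \<subseteq> \<Union>D"
      "\<forall>U\<in>D. bounded U \<and> diameter U \<le> \<delta>"
    using covering_number_attained[OF assms(1-3)] by blast
  have "\<forall>x\<in>P. \<exists>U\<in>D. x \<in> U" using \<open>P \<subseteq> F\<close> D(3) by blast
  then obtain h where h: "\<And>x. x \<in> P \<Longrightarrow> h x \<in> D \<and> x \<in> h x" by metis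
  have "inj_on h P"
  proof (rule inj_onI, rule ccontr)
    fix x y assume xy: "x \<in> P" "y \<in> P" "h x = h y" "x \<noteq> y"
    then have "dist x y \<le> diameter (h x)"
      using h D(4) by (metis diameter_bounded_bound)
    with separated[OF xy(1,2,4)] D(4) h[OF xy(1)] show False by force
  qed
  moreover have "h ` P \<subseteq> D" using h by blast
  ultimately show ?thesis using card_inj_on_le D(1,2) by metis
qed

text \<open>A constant factor \<open>k\<close> in the covering number contributes \<open>ln k / - ln \<delta>\<close> to the quotient
  that defines the dimension, which vanishes in the limit.\<close>

lemma has_box_dim_if_covering_number_bounds:
  fixes c C d :: real
  assumes "0 < c" "0 < C"
    and ev: "\<forall>\<^sub>F \<delta> in at_right 0. c * \<delta> powr (- d) \<le> real (covering_number F \<delta>) \<and>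
                real (covering_number F \<delta>) \<le> C * \<delta> powr (- d)"
  shows "has_box_dim F d"
proof -
  have lim: "((\<lambda>\<delta>. ln k / - ln \<delta> + d) \<longlongrightarrow> d) (at_right 0)" for k :: real
  proof -
    have "filterlim (\<lambda>\<delta>::real. - ln \<delta>) at_top (at_right 0)"
      using ln_at_0 by (simp add: filterlim_uminus_at_bot)
    then have "((\<lambda>\<delta>. ln k / - ln \<delta>) \<longlongrightarrow> 0) (at_right 0)"
      by (rule real_tendsto_divide_at_top[OF tendsto_const])
    from tendsto_add[OF this tendsto_const] show ?thesis by simp
  qed
  have small: "\<forall>\<^sub>F \<delta> in at_right 0. 0 < \<delta> \<and> \<delta> < (1::real)"
    unfolding eventually_at_right_field by (auto intro: exI[of _ 1])
  have log_power: "ln (k * \<delta> powr (- d)) / - ln \<delta> = ln k / - ln \<delta> + d"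
    if "0 < k" "0 < \<delta>" "\<delta> < 1" for k \<delta> :: real
    using that by (simp add: ln_mult ln_powr field_simps)
  have bounds: "\<forall>\<^sub>F \<delta> in at_right 0.
          ln c / - ln \<delta> + d \<le> ln (real (covering_number F \<delta>)) / - ln \<delta> \<and>
          ln (real (covering_number F \<delta>)) / - ln \<delta> \<le> ln C / - ln \<delta> + d"
    using ev small
  proof eventually_elim
    case (elim \<delta>)
    let ?n = "real (covering_number F \<delta>)"
    have pos: "0 < c * \<delta> powr (- d)" and "0 < - ln \<delta>" using elim assms by auto
    moreover have "ln (c * \<delta> powr (- d)) \<le> ln ?n" "ln ?n \<le> ln (C * \<delta> powr (- d))"
      using elim pos by (auto intro!: ln_mono simp del: of_nat_0_less_iff)
    ultimately have "ln (c * \<delta> powr (- d)) / - ln \<delta> \<le> ln ?n / - ln \<delta>"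
        "ln ?n / - ln \<delta> \<le> ln (C * \<delta> powr (- d)) / - ln \<delta>"
      by (meson divide_right_mono less_imp_le)+
    then show ?case using log_power[of c \<delta>] log_power[of C \<delta>] elim assms by simp
  qed
  have "((\<lambda>\<delta>. ln (real (covering_number F \<delta>)) / - ln \<delta>) \<longlongrightarrow> d) (at_right 0)"
    by (rule tendsto_sandwich[OF _ _ lim[of c] lim[of C]]; rule eventually_mono[OF bounds]; simp)
  then have "((\<lambda>\<delta>. ereal (ln (real (covering_number F \<delta>)) / - ln \<delta>)) \<longlongrightarrow> ereal d) (at_right 0)"
    by simp
  then show ?thesis
    unfolding has_box_dim_def lower_box_dim_def upper_box_dim_def
    by (simp add: lim_imp_Liminf lim_imp_Limsup trivial_limit_at_right_real)
qed

section \<open>Covering graphs of Holder functions\<close>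

lemma card_int_between_le:
  fixes x w :: real
  assumes "0 \<le> w"
  shows "real (card {\<lfloor>x\<rfloor>..\<lfloor>x + w\<rfloor>}) \<le> w + 2"
proof -
  have "\<lfloor>x\<rfloor> \<le> \<lfloor>x + w\<rfloor>" using assms by (simp add: floor_mono)
  then show ?thesis by simp linarith
qed

text \<open>The sets of the cover are the parts of the graph in the cells of a square grid of mesh
  \<open>\<delta> / 2\<close>. Within a grid column \<open>g\<close> stays within \<open>k \<delta> powr s\<close> of its value at any one point of the
  column, so the graph meets at most \<open>4 k \<delta> powr (s - 1) + 2\<close> cells of it. Both constants \<open>2\<close> are absorbed because
  \<open>1 \<le> \<delta> powr (s - 1)\<close> and \<open>1 \<le> 1 / \<delta>\<close>.\<close>

lemma holder_graph_cover:
  fixes A B k s \<delta> :: real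
  assumes "A \<le> B" "holder_on {A..B} s k g" "0 \<le> k" "0 < s" "s \<le> 1" "0 < \<delta>" "\<delta> < 1"
  obtains C where "finite C" "graph_on {A..B} g \<subseteq> \<Union>C"
    "\<forall>U\<in>C. bounded U \<and> diameter U \<le> \<delta>"
    "real (card C) \<le> (2 * (B - A) + 2) * (4 * k + 2) * \<delta> powr (s - 2)"
proof -
  define cell where "cell = (\<lambda>t. (\<lfloor>2 * t / \<delta>\<rfloor>, \<lfloor>2 * g t / \<delta>\<rfloor>))"
  define rep where "rep = (\<lambda>i. SOME t. t \<in> {A..B} \<and> \<lfloor>2 * t / \<delta>\<rfloor> = i)"
  define cols where "cols = {\<lfloor>2 * A / \<delta>\<rfloor>..\<lfloor>2 * A / \<delta> + 2 * (B - A) / \<delta>\<rfloor>}"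
  \<comment> \<open>\<open>rep i\<close> is a reference point in grid column \<open>i\<close>; \<open>w\<close> bounds the height of the graph over a
    column, measured in cells.\<close>
  define w where "w = 4 * k * \<delta> powr (s - 1)"
  define rows where "rows = (\<lambda>i. let y = 2 * g (rep i) / \<delta> - w / 2 in {\<lfloor>y\<rfloor>..\<lfloor>y + w\<rfloor>})"
  define part where "part = (\<lambda>c. {(t, g t) | t. t \<in> {A..B} \<and> cell t = c})"
  define C where "C = part ` (SIGMA i:cols. rows i)"
  have w0: "0 \<le> w" using assms by (simp add: w_def)
  have near: "\<bar>x - y\<bar> \<le> \<delta> / 2" if "\<lfloor>2 * x / \<delta>\<rfloor> = \<lfloor>2 * y / \<delta>\<rfloor>" for x y
  proof -
    have "2 * x / \<delta> - 2 * y / \<delta> \<le> 1" "2 * y / \<delta> - 2 * x / \<delta> \<le> 1" using that by linarith+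
    then have "2 * x - 2 * y \<le> \<delta>" "2 * y - 2 * x \<le> \<delta>"
      using \<open>0 < \<delta>\<close> by (simp_all add: field_simps)
    then show ?thesis by linarith
  qed
  have cell_in: "cell t \<in> (SIGMA i:cols. rows i)" if t: "t \<in> {A..B}" for t
  proof -
    define i where "i = \<lfloor>2 * t / \<delta>\<rfloor>"
    define r where "r = rep i"
    have rep: "r \<in> {A..B}" "\<lfloor>2 * r / \<delta>\<rfloor> = i"
      unfolding r_def rep_def using someI[of "\<lambda>u. u \<in> {A..B} \<and> \<lfloor>2 * u / \<delta>\<rfloor> = i" t] t
      by (auto simp: i_def)
    have "\<bar>t - r\<bar> \<le> \<delta> / 2" using near rep(2) i_def by metis
    then have "\<bar>t - r\<bar> powr s \<le> \<delta> powr s"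
      using assms by (intro powr_mono2) auto
    moreover have "\<bar>g t - g r\<bar> \<le> k * \<bar>t - r\<bar> powr s"
      using assms(2) t rep(1) unfolding holder_on_def by blast
    ultimately have g_near: "\<bar>g t - g r\<bar> \<le> k * \<delta> powr s"
      using \<open>0 \<le> k\<close> by (meson mult_left_mono order_trans)
    have "\<delta> powr s = \<delta> * \<delta> powr (s - 1)" using assms by (simp add: powr_diff)
    then have "4 * \<bar>g t - g r\<bar> \<le> w * \<delta>"
      using g_near by (simp add: w_def mult_ac)
    then have "4 * (g t - g r) \<le> w * \<delta>" "4 * (g r - g t) \<le> w * \<delta>"
      by argo+
    then have "2 * (g t - g r) / \<delta> \<le> w / 2" "2 * (g r - g t) / \<delta> \<le> w / 2"
      using \<open>0 < \<delta>\<close> by (simp_all add: pos_divide_le_eq)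
    then have "2 * g t / \<delta> - 2 * g r / \<delta> \<le> w / 2" "2 * g r / \<delta> - 2 * g t / \<delta> \<le> w / 2"
      by (simp_all add: diff_divide_distrib right_diff_distrib)
    then have "\<lfloor>2 * g t / \<delta>\<rfloor> \<in> rows i"
      unfolding rows_def Let_def r_def[symmetric] atLeastAtMost_iff
      by (intro conjI floor_mono) linarith+
    moreover have "2 * A / \<delta> \<le> 2 * t / \<delta>" "2 * t / \<delta> \<le> 2 * A / \<delta> + 2 * (B - A) / \<delta>"
      using t \<open>0 < \<delta>\<close> by (auto simp: field_simps)
    then have "i \<in> cols" unfolding cols_def i_def by (auto intro!: floor_mono)
    ultimately show ?thesis by (simp add: cell_def i_def)
  qed
  have fin: "finite cols" "\<And>i. finite (rows i)" by (auto simp: cols_def rows_def Let_def)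
  have "finite C" unfolding C_def using fin by auto
  moreover have "graph_on {A..B} g \<subseteq> \<Union>C"
    unfolding C_def part_def graph_on_def using cell_in by blast
  moreover have "bounded U \<and> diameter U \<le> \<delta>" if UC: "U \<in> C" for U
  proof -
    obtain i l where U: "U = part (i, l)" using UC by (auto simp: C_def)
    have d: "dist x y \<le> \<delta>" if xy: "x \<in> U" "y \<in> U" for x y
    proof -
      obtain t u where tu: "x = (t, g t)" "y = (u, g u)" "cell t = cell u"
        using xy by (auto simp: U part_def)
      then have "\<bar>t - u\<bar> \<le> \<delta> / 2" "\<bar>g t - g u\<bar> \<le> \<delta> / 2"
        using near by (simp_all add: cell_def)
      moreover have "dist x y \<le> \<bar>t - u\<bar> + \<bar>g t - g u\<bar>"
        unfolding tu dist_Pair_Pair dist_real_def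
        using sqrt_sum_squares_le_sum_abs[of "\<bar>t - u\<bar>" "\<bar>g t - g u\<bar>"] by simp
      ultimately show ?thesis by linarith
    qed
    have "bounded U" unfolding bounded_two_points using d by blast
    moreover have "diameter U \<le> \<delta>"
      by (rule diameter_le) (use d \<open>0 < \<delta>\<close> in \<open>auto simp: dist_norm\<close>)
    ultimately show ?thesis by simp
  qed
  moreover have "real (card C) \<le> (2 * (B - A) + 2) * (4 * k + 2) * \<delta> powr (s - 2)"
  proof -
    have one: "1 \<le> \<delta> powr (s - 1)"
      using assms powr_mono'[of "s - 1" 0 \<delta>] by simp
    have "real (card C) \<le> real (card (SIGMA i:cols. rows i))"
      unfolding C_def of_nat_le_iff using fin by (intro card_image_le finite_SigmaI)
    also have "\<dots> = (\<Sum>i\<in>cols. real (card (rows i)))" using fin by (simp add: card_SigmaI)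
    also have "\<dots> \<le> (\<Sum>i\<in>cols. w + 2)"
      unfolding rows_def Let_def by (intro sum_mono card_int_between_le w0)
    also have "\<dots> = real (card cols) * (w + 2)" by simp
    also have "\<dots> \<le> (2 * (B - A) / \<delta> + 2) * (w + 2)"
      unfolding cols_def
      using assms w0 by (intro mult_right_mono card_int_between_le) auto
    also have "\<dots> \<le> ((2 * (B - A) + 2) / \<delta>) * ((4 * k + 2) * \<delta> powr (s - 1))"
    proof (rule mult_mono)
      show "2 * (B - A) / \<delta> + 2 \<le> (2 * (B - A) + 2) / \<delta>"
        using assms by (simp add: field_simps)
      show "w + 2 \<le> (4 * k + 2) * \<delta> powr (s - 1)"
        using one by (simp add: w_def algebra_simps)
    qed (use assms w0 in auto)
    also have "\<dots> = (2 * (B - A) + 2) * (4 * k + 2) * (\<delta> powr (s - 1) / \<delta>)" by simp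
    also have "\<delta> powr (s - 1) / \<delta> = \<delta> powr (s - 2)"
      using assms powr_diff[of \<delta> "s - 1" 1] by simp
    finally show ?thesis .
  qed
  ultimately show ?thesis using that by blast
qed

lemma holder_covering_number_le:
  fixes A B k s \<delta> :: real
  assumes "A \<le> B" "holder_on {A..B} s k g" "0 \<le> k" "0 < s" "s \<le> 1" "0 < \<delta>" "\<delta> < 1"
  shows "real (covering_number (graph_on {A..B} g) \<delta>)
           \<le> (2 * (B - A) + 2) * (4 * k + 2) * \<delta> powr (s - 2)"
proof -
  obtain C where C: "finite C" "graph_on {A..B} g \<subseteq> \<Union>C"
    "\<forall>U\<in>C. bounded U \<and> diameter U \<le> \<delta>"
    "real (card C) \<le> (2 * (B - A) + 2) * (4 * k + 2) * \<delta> powr (s - 2)"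
    using holder_graph_cover[OF assms] by blast
  have "covering_number (graph_on {A..B} g) \<delta> \<le> card C"
    using covering_number_le_card[OF C(1-3)] .
  then have "real (covering_number (graph_on {A..B} g) \<delta>) \<le> real (card C)"
    by simp
  with C(4) show ?thesis by (rule order_trans[rotated])
qed

section \<open>Separated points on oscillating graphs\<close>

text \<open>In columns of width \<open>2 \<delta>\<close> with gaps of width \<open>2 \<delta>\<close> between them, the intermediate value
  theorem yields points at heights spaced by \<open>2 \<delta>\<close>. About \<open>(B - A) / (4 \<delta>)\<close> columns fit into
  \<open>[A, B]\<close>, and each carries at least \<open>K \<delta> powr (s - 1) / 2\<close> points, since the graph oscillates
  by \<open>K \<delta> powr s\<close> around the centre of the column.\<close>

lemma oscillating_graph_separated_points:
  fixes A B K s \<delta> :: real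
  assumes "A < B" "continuous_on {A..B} g" "0 < K" "0 < \<delta>" "8 * \<delta> \<le> B - A"
    and osc: "\<And>t. A + \<delta> \<le> t \<Longrightarrow> t \<le> B - \<delta> \<Longrightarrow> \<exists>u. \<bar>t - u\<bar> \<le> \<delta> \<and> K * \<delta> powr s \<le> \<bar>g t - g u\<bar>"
  obtains P where "finite P" "P \<subseteq> graph_on {A..B} g"
    "\<And>x y. x \<in> P \<Longrightarrow> y \<in> P \<Longrightarrow> x \<noteq> y \<Longrightarrow> \<delta> < dist x y"
    "(B - A) * K / 16 * \<delta> powr (s - 2) \<le> real (card P)"
proof -
  \<comment> \<open>\<open>n\<close> columns of width \<open>2 \<delta>\<close> with centres \<open>c i\<close>, carrying \<open>m + 1\<close> points each; the extra
    point matters when \<open>s = 1\<close>, where \<open>m\<close> may be \<open>0\<close> for all \<open>\<delta>\<close>.\<close>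
  define n where "n = nat \<lfloor>(B - A) / (4 * \<delta>)\<rfloor>"
  define m where "m = nat \<lfloor>K * \<delta> powr (s - 1) / 2\<rfloor>"
  define c where "c = (\<lambda>i::nat. A + \<delta> + 4 * \<delta> * real i)"
  have split: "\<delta> powr s = \<delta> * \<delta> powr (s - 1)" using assms by (simp add: powr_diff)
  have fits: "c i \<le> B - \<delta>" if "i < n" for i
  proof -
    have "real n \<le> (B - A) / (4 * \<delta>)" using assms by (simp add: n_def)
    then have "4 * \<delta> * real n \<le> B - A" using \<open>0 < \<delta>\<close> by (simp add: field_simps)
    moreover have "4 * \<delta> * (real i + 1) \<le> 4 * \<delta> * real n"
      using that \<open>0 < \<delta>\<close> by (intro mult_left_mono) auto
    ultimately show ?thesis using \<open>0 < \<delta>\<close> by (simp add: c_def algebra_simps)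
  qed
  have "\<exists>v. \<forall>l\<le>m. \<exists>t. \<bar>t - c i\<bar> \<le> \<delta> \<and> t \<in> {A..B} \<and> g t = v + 2 * \<delta> * real l" if "i < n" for i
  proof -
    have ci: "A + \<delta> \<le> c i" "c i \<le> B - \<delta>" using fits[OF that] \<open>0 < \<delta>\<close> by (auto simp: c_def)
    then obtain u where u: "\<bar>c i - u\<bar> \<le> \<delta>" "K * \<delta> powr s \<le> \<bar>g (c i) - g u\<bar>"
      using osc by blast
    define lo hi where "lo = min (c i) u" and "hi = max (c i) u"
    have seg: "{lo..hi} \<subseteq> {A..B}" "\<And>t. t \<in> {lo..hi} \<Longrightarrow> \<bar>t - c i\<bar> \<le> \<delta>" "lo \<le> hi"
      using u(1) ci by (auto simp: lo_def hi_def min_def max_def split: if_splits)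
    have cont: "continuous_on {lo..hi} g" using assms(2) seg(1) continuous_on_subset by blast
    have hgt: "K * \<delta> powr s \<le> \<bar>g lo - g hi\<bar>"
      using u(2) by (auto simp: lo_def hi_def min_def max_def)
    let ?v = "min (g lo) (g hi)"
    have "\<exists>t. \<bar>t - c i\<bar> \<le> \<delta> \<and> t \<in> {A..B} \<and> g t = ?v + 2 * \<delta> * real l" if "l \<le> m" for l
    proof -
      have "real l \<le> K * \<delta> powr (s - 1) / 2"
        using that \<open>0 < K\<close> by (simp add: m_def le_nat_iff le_floor_iff)
      then have "2 * \<delta> * real l \<le> K * \<delta> powr s"
        using \<open>0 < \<delta>\<close> by (simp add: split field_simps)
      moreover have "0 \<le> 2 * \<delta> * real l" using \<open>0 < \<delta>\<close> by simp
      ultimately have between: "?v \<le> ?v + 2 * \<delta> * real l" "?v + 2 * \<delta> * real l \<le> max (g lo) (g hi)"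
        using hgt by (auto simp: min_def max_def)
      have "\<exists>t. lo \<le> t \<and> t \<le> hi \<and> g t = ?v + 2 * \<delta> * real l"
      proof (cases "g lo \<le> g hi")
        case True
        then show ?thesis using between IVT'[OF _ _ seg(3) cont] by (simp add: min_def max_def)
      next
        case False
        then show ?thesis using between IVT2'[OF _ _ seg(3) cont] by (simp add: min_def max_def)
      qed
      then show ?thesis using seg by (meson atLeastAtMost_iff subsetD)
    qed
    then show ?thesis by blast
  qed
  then obtain v where "\<And>i. i < n \<Longrightarrow> \<forall>l\<le>m. \<exists>t. \<bar>t - c i\<bar> \<le> \<delta> \<and> t \<in> {A..B} \<and> g t = v i + 2 * \<delta> * real l"
    by metis
  then obtain t where t: "\<And>i l. i < n \<Longrightarrow> l \<le> m \<Longrightarrow>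
      \<bar>t i l - c i\<bar> \<le> \<delta> \<and> t i l \<in> {A..B} \<and> g (t i l) = v i + 2 * \<delta> * real l"
    by metis
  define pt where "pt = (\<lambda>(i, l). (t i l, g (t i l)))"
  define Q where "Q = {..<n} \<times> {..m}"
  have spaced: "2 * \<delta> * \<bar>real a - real b\<bar> \<ge> 2 * \<delta>" if "a \<noteq> b" for a b :: nat
  proof -
    have "1 \<le> \<bar>real a - real b\<bar>" using that by linarith
    then show ?thesis using \<open>0 < \<delta>\<close> by simp
  qed
  have sep: "\<delta> < dist (pt q) (pt r)" if qr: "q \<in> Q" "r \<in> Q" "q \<noteq> r" for q r
  proof -
    obtain i l j k where ij: "q = (i, l)" "r = (j, k)" by (metis surj_pair)
    then have lt: "i < n" "j < n" "l \<le> m" "k \<le> m" using qr by (auto simp: Q_def)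
    \<comment> \<open>Points of one column differ in height, points of different columns in abscissa.\<close>
    show ?thesis
    proof (cases "i = j")
      case True
      then have "l \<noteq> k" using qr ij by auto
      have "g (t i l) - g (t j k) = 2 * \<delta> * (real l - real k)"
        using t[OF lt(1,3)] t[OF lt(2,4)] True by (simp add: algebra_simps)
      then have "\<bar>g (t i l) - g (t j k)\<bar> = 2 * \<delta> * \<bar>real l - real k\<bar>"
        using \<open>0 < \<delta>\<close> by (simp add: abs_mult)
      then have "2 * \<delta> \<le> \<bar>g (t i l) - g (t j k)\<bar>" using spaced[OF \<open>l \<noteq> k\<close>] by simp
      also have "\<dots> \<le> dist (pt q) (pt r)"
        using dist_snd_le[of "pt q" "pt r"] by (simp add: pt_def ij dist_real_def)
      finally show ?thesis using \<open>0 < \<delta>\<close> by simp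
    next
      case False
      have "c i - c j = 2 * (2 * \<delta> * (real i - real j))" by (simp add: c_def algebra_simps)
      then have "\<bar>c i - c j\<bar> = 2 * (2 * \<delta> * \<bar>real i - real j\<bar>)"
        using \<open>0 < \<delta>\<close> by (simp add: abs_mult)
      then have "4 * \<delta> \<le> \<bar>c i - c j\<bar>" using spaced[OF False] by simp
      then have "2 * \<delta> \<le> \<bar>t i l - t j k\<bar>" using t[OF lt(1,3)] t[OF lt(2,4)] by linarith
      also have "\<dots> \<le> dist (pt q) (pt r)"
        using dist_fst_le[of "pt q" "pt r"] by (simp add: pt_def ij dist_real_def)
      finally show ?thesis using \<open>0 < \<delta>\<close> by simp
    qed
  qed
  have "inj_on pt Q"
    by (rule inj_onI, rule ccontr) (use sep \<open>0 < \<delta>\<close> in force)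
  then have "card (pt ` Q) = n * (m + 1)" by (simp add: card_image Q_def)
  moreover have "(B - A) * K / 16 * \<delta> powr (s - 2) \<le> real (n * (m + 1))"
  proof -
    have "\<delta> powr (s - 2) = \<delta> powr (s - 1) / \<delta>"
      using assms powr_diff[of \<delta> "s - 1" 1] by simp
    then have "(B - A) * K / 16 * \<delta> powr (s - 2)
        = ((B - A) / (8 * \<delta>)) * (K * \<delta> powr (s - 1) / 2)" by simp
    also have "\<dots> \<le> real n * (real m + 1)"
    proof (rule mult_mono)
      \<comment> \<open>Since \<open>8 * \<delta> \<le> B - A\<close>, rounding down loses at most half of the columns.\<close>
      have "1 \<le> (B - A) / (8 * \<delta>)" using assms by (simp add: field_simps)
      moreover have "(B - A) / (4 * \<delta>) = 2 * ((B - A) / (8 * \<delta>))"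
        using \<open>0 < \<delta>\<close> by (simp add: field_simps)
      moreover have "(B - A) / (4 * \<delta>) - 1 \<le> real n" unfolding n_def by linarith
      ultimately show "(B - A) / (8 * \<delta>) \<le> real n" by linarith
      show "K * \<delta> powr (s - 1) / 2 \<le> real m + 1" unfolding m_def by linarith
    qed (use assms in auto)
    finally show ?thesis by (simp add: algebra_simps)
  qed
  moreover have "pt ` Q \<subseteq> graph_on {A..B} g"
    using t by (auto simp: Q_def pt_def graph_on_def)
  moreover have "\<delta> < dist x y" if "x \<in> pt ` Q" "y \<in> pt ` Q" "x \<noteq> y" for x y
    using that sep by auto
  moreover have "finite (pt ` Q)" by (simp add: Q_def)
  ultimately show ?thesis using that[of "pt ` Q"] by simp
qed

lemma oscillating_covering_number_ge:
  fixes A B K s \<delta> :: real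
  assumes "A < B" "continuous_on {A..B} g" "0 < K" "0 < \<delta>" "8 * \<delta> \<le> B - A"
    and "\<And>t. A + \<delta> \<le> t \<Longrightarrow> t \<le> B - \<delta> \<Longrightarrow> \<exists>u. \<bar>t - u\<bar> \<le> \<delta> \<and> K * \<delta> powr s \<le> \<bar>g t - g u\<bar>"
    and "graph_on {A..B} g \<subseteq> F"
    and "finite C" "F \<subseteq> \<Union>C" "\<forall>U\<in>C. bounded U \<and> diameter U \<le> \<delta>"
  shows "(B - A) * K / 16 * \<delta> powr (s - 2) \<le> real (covering_number F \<delta>)"
proof -
  obtain P where P: "finite P" "P \<subseteq> graph_on {A..B} g"
    "\<And>x y. x \<in> P \<Longrightarrow> y \<in> P \<Longrightarrow> x \<noteq> y \<Longrightarrow> \<delta> < dist x y"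
    "(B - A) * K / 16 * \<delta> powr (s - 2) \<le> real (card P)"
    using oscillating_graph_separated_points[OF assms(1-6)] by blast
  have "card P \<le> covering_number F \<delta>"
    by (rule card_separated_le_covering_number[OF assms(8-10)]) (use P assms(7) in auto)
  with P(4) show ?thesis by (meson of_nat_le_iff order_trans)
qed

section \<open>Pieces of the partition and bounds on the data\<close>

lemma abs_le_sup_norm:
  assumes "continuous_on {A..B} h" "t \<in> {A..B}"
  shows "\<bar>h t\<bar> \<le> sup_norm {A..B} h"
proof -
  have "compact ((\<lambda>t. \<bar>h t\<bar>) ` {A..B})"
    using assms by (intro compact_continuous_image continuous_intros) auto
  then have "bdd_above ((\<lambda>t. \<bar>h t\<bar>) ` {A..B})"
    by (simp add: bounded_imp_bdd_above compact_imp_bounded)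
  then show ?thesis unfolding sup_norm_def using assms(2) by (rule cSUP_upper2) simp
qed

lemma piece_slope_pos:
  assumes "strict_mono_on {1..N} p" "j \<in> {1..N - 1}"
  shows "0 < piece_slope N p j"
proof -
  have "p j < p (j + 1)" "p 1 < p N"
    using assms by (auto intro!: strict_mono_onD[OF assms(1)])
  then show ?thesis by (simp add: piece_slope_def)
qed

lemma piece_subset:
  fixes p :: "nat \<Rightarrow> real"
  assumes "strict_mono_on {1..N} p" "j \<in> {1..N - 1}"
  shows "{p j..p (j + 1)} \<subseteq> {p 1..p N}"
proof -
  have "p 1 \<le> p j" "p (j + 1) \<le> p N"
    using assms(2) by (auto intro!: strict_mono_on_leD[OF assms(1)])
  then show ?thesis by auto
qed

lemma piece_inverse:
  assumes "strict_mono_on {1..N} p" "j \<in> {1..N - 1}" "t \<in> {p j..p (j + 1)}"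
  defines "u \<equiv> the_inv_into {p 1..p N} (piece_map N p j) t"
  shows "u \<in> {p 1..p N}" and "piece_map N p j u = t"
proof -
  have less: "p 1 < p N" using assms by (auto intro!: strict_mono_onD[OF assms(1)])
  have pos: "0 < piece_slope N p j" using piece_slope_pos assms by blast
  have inj: "inj_on (piece_map N p j) {p 1..p N}"
    using pos by (auto intro!: inj_onI simp: piece_map_def)
  have "\<exists>x\<ge>p 1. x \<le> p N \<and> piece_map N p j x = t"
    by (rule IVT') (use assms(3) less piece_map_endpoints[of p N j, OF less] in
        \<open>auto simp: piece_map_def intro!: continuous_intros\<close>)
  then have t: "t \<in> piece_map N p j ` {p 1..p N}" by auto
  show "u \<in> {p 1..p N}" unfolding u_def using the_inv_into_into[OF inj t] by blast
  show "piece_map N p j u = t" unfolding u_def using f_the_inv_into_f[OF inj t] .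
qed

lemma fractal_function_on_piece:
  assumes "strict_mono_on {1..N} p" "is_fractal_function N p f b \<alpha> g"
    "j \<in> {1..N - 1}" "t \<in> {p j..p (j + 1)}"
  obtains u where "u \<in> {p 1..p N}" "piece_map N p j u = t"
    "g t = f t + \<alpha> j u * (g u - b u)"
  using piece_inverse[OF assms(1,3,4)] assms(2-4)
  unfolding is_fractal_function_def Let_def by metis

lemma in_some_piece:
  fixes p :: "nat \<Rightarrow> real"
  assumes "2 \<le> N" "t \<in> {p 1..p N}"
  shows "\<exists>j\<in>{1..N - 1}. t \<in> {p j..p (j + 1)}"
  using assms
proof (induction N rule: dec_induct)
  case base
  then show ?case by (auto simp: numeral_2_eq_2)
next
  case (step n)
  show ?case
  proof (cases "t \<le> p n")
    case True
    then obtain j where "j \<in> {1..n - 1}" "t \<in> {p j..p (j + 1)}" using step by auto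
    then show ?thesis by (intro bexI[of _ j]) auto
  next
    case False
    then show ?thesis using step by (intro bexI[of _ n]) auto
  qed
qed

lemma abs_scaling_le:
  assumes "j \<in> {1..N - 1}" "continuous_on {p 1..p N} (\<alpha> j)" "u \<in> {p 1..p N}"
  shows "\<bar>\<alpha> j u\<bar> \<le> scaling_sup_norm N p \<alpha>"
proof -
  have "\<bar>\<alpha> j u\<bar> \<le> sup_norm {p 1..p N} (\<alpha> j)" using abs_le_sup_norm assms by blast
  also have "\<dots> \<le> scaling_sup_norm N p \<alpha>"
    unfolding scaling_sup_norm_def using assms(1) by (intro Max_ge) auto
  finally show ?thesis .
qed

text \<open>This gives \<open>\<parallel>\<alpha>\<parallel> \<le> scaling_holder_norm N p s \<alpha>\<close>. The Holder condition makes the set of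
  difference quotients bounded above, so that its supremum dominates its elements.\<close>

lemma scaling_seminorm_nonneg:
  assumes "2 \<le> N" "p 1 < p N" "holder_on {p 1..p N} s k (\<alpha> 1)"
  shows "0 \<le> scaling_seminorm N p s \<alpha>"
proof -
  let ?S = "\<lambda>j. {\<bar>\<alpha> j t - \<alpha> j u\<bar> / \<bar>t - u\<bar> powr s | t u.
              t \<in> {p 1..p N} \<and> u \<in> {p 1..p N} \<and> t \<noteq> u}"
  have mem: "\<bar>\<alpha> 1 (p 1) - \<alpha> 1 (p N)\<bar> / \<bar>p 1 - p N\<bar> powr s \<in> ?S 1"
    using assms(2) by (intro CollectI exI[of _ "p 1"] exI[of _ "p N"]) auto
  have "x \<le> k" if x: "x \<in> ?S 1" for x
  proof -
    obtain t u where tu: "x = \<bar>\<alpha> 1 t - \<alpha> 1 u\<bar> / \<bar>t - u\<bar> powr s"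
        "t \<in> {p 1..p N}" "u \<in> {p 1..p N}" "t \<noteq> u"
      using x by blast
    then have "\<bar>\<alpha> 1 t - \<alpha> 1 u\<bar> \<le> k * \<bar>t - u\<bar> powr s" using assms(3) by (auto simp: holder_on_def)
    moreover have "0 < \<bar>t - u\<bar> powr s" using tu(4) by simp
    ultimately show ?thesis unfolding tu(1) by (simp add: pos_divide_le_eq)
  qed
  then have "bdd_above (?S 1)" unfolding bdd_above_def by blast
  then have "0 \<le> Sup (?S 1)" by (intro cSup_upper2[OF mem]) auto
  also have "\<dots> \<le> scaling_seminorm N p s \<alpha>"
    unfolding scaling_seminorm_def using assms(1) by (intro Max_ge) auto
  finally show ?thesis .
qed

text \<open>The equation gives \<open>\<parallel>f\<^sup>\<alpha> - f\<parallel> \<le> \<parallel>\<alpha>\<parallel> \<parallel>f\<^sup>\<alpha> - b\<parallel> \<le> \<parallel>\<alpha>\<parallel> (\<parallel>f\<^sup>\<alpha> - f\<parallel> + \<parallel>f - b\<parallel>)\<close>, which is solved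
  for \<open>\<parallel>f\<^sup>\<alpha> - f\<parallel>\<close> because \<open>\<parallel>\<alpha>\<parallel> < 1\<close>.\<close>

lemma abs_fractal_function_le:
  assumes "2 \<le> N" "strict_mono_on {1..N} p" "is_fractal_function N p f b \<alpha> g"
    and "continuous_on {p 1..p N} f" "continuous_on {p 1..p N} b"
    and "\<And>j. j \<in> {1..N - 1} \<Longrightarrow> continuous_on {p 1..p N} (\<alpha> j)"
    and "scaling_sup_norm N p \<alpha> < 1" and t: "t \<in> {p 1..p N}"
  shows "\<bar>g t\<bar> \<le> fractal_bound N p f b \<alpha>"
proof -
  let ?I = "{p 1..p N}" and ?A = "scaling_sup_norm N p \<alpha>"
  let ?D = "sup_norm ?I (\<lambda>t. g t - f t)" and ?E = "sup_norm ?I (\<lambda>t. f t - b t)"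
  have g: "continuous_on ?I g" using assms(3) by (simp add: is_fractal_function_def)
  have D: "\<bar>g u - f u\<bar> \<le> ?D" and E: "\<bar>f u - b u\<bar> \<le> ?E" if "u \<in> ?I" for u
    using that g assms(4,5)
      abs_le_sup_norm[of "p 1" "p N" "\<lambda>t. g t - f t" u]
      abs_le_sup_norm[of "p 1" "p N" "\<lambda>t. f t - b t" u]
    by (auto intro: continuous_intros)
  have "\<bar>g x - f x\<bar> \<le> ?A * (?D + ?E)" if x: "x \<in> ?I" for x
  proof -
    obtain j where j: "j \<in> {1..N - 1}" "x \<in> {p j..p (j + 1)}"
      using in_some_piece[OF assms(1) x] by blast
    obtain u where u: "u \<in> ?I" "g x = f x + \<alpha> j u * (g u - b u)"
      using fractal_function_on_piece[OF assms(2,3) j] by blast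
    have \<alpha>: "\<bar>\<alpha> j u\<bar> \<le> ?A" using abs_scaling_le j(1) assms(6) u(1) by blast
    have "\<bar>g x - f x\<bar> = \<bar>\<alpha> j u\<bar> * \<bar>g u - b u\<bar>" using u(2) by (simp add: abs_mult)
    also have "\<dots> \<le> ?A * (?D + ?E)"
    proof (rule mult_mono[OF \<alpha>])
      show "\<bar>g u - b u\<bar> \<le> ?D + ?E" using D[OF u(1)] E[OF u(1)] by linarith
    qed (use \<alpha> in auto)
    finally show ?thesis .
  qed
  then have "?D \<le> ?A * (?D + ?E)"
    unfolding sup_norm_def[of _ "\<lambda>t. g t - f t"] using t by (intro cSUP_least) auto
  then have "?D * (1 - ?A) \<le> ?A * ?E" by (simp add: algebra_simps)
  then have "?D \<le> ?A / (1 - ?A) * ?E" using assms(7) by (simp add: field_simps)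
  moreover have "\<bar>f t\<bar> \<le> sup_norm ?I f" using abs_le_sup_norm assms(4) t by blast
  ultimately show ?thesis unfolding fractal_bound_def using D[OF t] by linarith
qed

section \<open>Oscillation of the fractal function\<close>

text \<open>Pulling \<open>x\<close> and \<open>y\<close> back along \<open>L\<^sub>j\<close> stretches their distance by \<open>1 / a\<^sub>j \<le> 1 / a\<close>; the rest is the
  product rule for increments, applied to \<open>\<alpha>\<^sub>j (f\<^sup>\<alpha> - b)\<close>.\<close>

lemma fractal_function_increment_ge:
  assumes mono: "strict_mono_on {1..N} p" and g: "is_fractal_function N p f b \<alpha> g"
    and j: "j \<in> {1..N - 1}" and xy: "x \<in> {p j..p (j + 1)}" "y \<in> {p j..p (j + 1)}"
    and near: "\<bar>x - y\<bar> \<le> \<delta>" and s: "0 < s" and k: "0 \<le> k_b" "0 \<le> k_g" "0 \<le> k_\<alpha>"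
    and hb: "holder_on {p 1..p N} s k_b b" and hg: "holder_on {p 1..p N} s k_g g"
    and h\<alpha>: "holder_on {p 1..p N} s k_\<alpha> (\<alpha> j)"
    and A: "\<And>u. u \<in> {p 1..p N} \<Longrightarrow> \<bar>\<alpha> j u\<bar> \<le> A"
    and R: "\<And>u. u \<in> {p 1..p N} \<Longrightarrow> \<bar>g u - b u\<bar> \<le> R"
    and a: "0 < a" "a \<le> piece_slope N p j"
  shows "\<bar>f x - f y\<bar> - (A * (k_g + k_b) + R * k_\<alpha>) * a powr (- s) * \<delta> powr s \<le> \<bar>g x - g y\<bar>"
proof -
  let ?I = "{p 1..p N}"
  obtain u where u: "u \<in> ?I" "piece_map N p j u = x" "g x = f x + \<alpha> j u * (g u - b u)"
    using fractal_function_on_piece[OF mono g j xy(1)] by blast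
  obtain v where v: "v \<in> ?I" "piece_map N p j v = y" "g y = f y + \<alpha> j v * (g v - b v)"
    using fractal_function_on_piece[OF mono g j xy(2)] by blast
  have "x - y = piece_slope N p j * (u - v)"
    using u(2) v(2) by (simp add: piece_map_def algebra_simps flip: u(2) v(2))
  then have "\<bar>x - y\<bar> = piece_slope N p j * \<bar>u - v\<bar>" using a by (simp add: abs_mult)
  then have "a * \<bar>u - v\<bar> \<le> \<delta>" using a near mult_right_mono[OF a(2), of "\<bar>u - v\<bar>"] by simp
  then have "\<bar>u - v\<bar> \<le> \<delta> / a" using a(1) by (simp add: field_simps)
  then have "\<bar>u - v\<bar> powr s \<le> (\<delta> / a) powr s" using s by (intro powr_mono2) auto
  also have "\<dots> = a powr (- s) * \<delta> powr s"
    using near a(1) by (subst powr_divide) (auto simp: powr_minus_divide)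
  finally have uv: "\<bar>u - v\<bar> powr s \<le> a powr (- s) * \<delta> powr s" .
  let ?q = "a powr (- s) * \<delta> powr s"
  have "\<bar>g u - g v\<bar> \<le> k_g * ?q" "\<bar>b u - b v\<bar> \<le> k_b * ?q" and \<alpha>uv: "\<bar>\<alpha> j u - \<alpha> j v\<bar> \<le> k_\<alpha> * ?q"
    using hg hb h\<alpha> u(1) v(1) k uv unfolding holder_on_def
    by (meson mult_left_mono order_trans)+
  then have gb: "\<bar>(g u - b u) - (g v - b v)\<bar> \<le> (k_g + k_b) * ?q" by (simp add: algebra_simps)
  have "\<bar>\<alpha> j u * ((g u - b u) - (g v - b v))\<bar> \<le> A * ((k_g + k_b) * ?q)"
    unfolding abs_mult by (intro mult_mono A u(1) gb order_trans[OF abs_ge_zero A[OF u(1)]]) auto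
  moreover have "\<bar>(\<alpha> j u - \<alpha> j v) * (g v - b v)\<bar> \<le> (k_\<alpha> * ?q) * R"
    unfolding abs_mult
    by (intro mult_mono \<alpha>uv R v(1)) (use k in auto)
  moreover have "g x - g y = (f x - f y) + \<alpha> j u * ((g u - b u) - (g v - b v))
      + (\<alpha> j u - \<alpha> j v) * (g v - b v)"
    unfolding u(3) v(3) by (simp add: algebra_simps)
  ultimately have "\<bar>f x - f y\<bar> - (A * ((k_g + k_b) * ?q) + (k_\<alpha> * ?q) * R) \<le> \<bar>g x - g y\<bar>"
    by linarith
  then show ?thesis by (simp add: algebra_simps)
qed

text \<open>Around a centre whose \<open>\<delta>\<close>-neighbourhood lies in one piece, the witness of oscillation of
  \<open>f\<close> also serves for the fractal function.\<close>

lemma fractal_function_oscillation: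
  assumes mono: "strict_mono_on {1..N} p" and g: "is_fractal_function N p f b \<alpha> g"
    and j: "j \<in> {1..N - 1}" and s: "0 < s" and k: "0 \<le> k_b" "0 \<le> k_g" "0 \<le> k_\<alpha>"
    and hb: "holder_on {p 1..p N} s k_b b" and hg: "holder_on {p 1..p N} s k_g g"
    and h\<alpha>: "holder_on {p 1..p N} s k_\<alpha> (\<alpha> j)"
    and A: "\<And>u. u \<in> {p 1..p N} \<Longrightarrow> \<bar>\<alpha> j u\<bar> \<le> A"
    and R: "\<And>u. u \<in> {p 1..p N} \<Longrightarrow> \<bar>g u - b u\<bar> \<le> R"
    and a: "0 < a" "a \<le> piece_slope N p j"
    and osc: "oscillates_on {p 1..p N} s K \<delta>0 f"
    and \<delta>: "0 < \<delta>" "\<delta> < \<delta>0" and t: "p j + \<delta> \<le> t" "t \<le> p (j + 1) - \<delta>"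
  shows "\<exists>u. \<bar>t - u\<bar> \<le> \<delta> \<and>
    (K - (A * (k_g + k_b) + R * k_\<alpha>) * a powr (- s)) * \<delta> powr s \<le> \<bar>g t - g u\<bar>"
proof -
  have tj: "t \<in> {p j..p (j + 1)}" using t \<delta> by auto
  then obtain u where u: "\<bar>t - u\<bar> \<le> \<delta>" "K * \<delta> powr s \<le> \<bar>f t - f u\<bar>"
    using osc \<delta> piece_subset[OF mono j] unfolding oscillates_on_def by blast
  have uj: "u \<in> {p j..p (j + 1)}" using u(1) t by auto
  have "\<bar>f t - f u\<bar> - (A * (k_g + k_b) + R * k_\<alpha>) * a powr (- s) * \<delta> powr s \<le> \<bar>g t - g u\<bar>"
    by (rule fractal_function_increment_ge[OF mono g j tj uj u(1) s k hb hg h\<alpha> A R a])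
  then show ?thesis using u by (intro exI[of _ u]) (simp add: algebra_simps)
qed

section \<open>The dimension of the graph\<close>


theorem theorem3p14:
  fixes N :: nat and p :: "nat \<Rightarrow> real"
    and f b f\<alpha> :: "real \<Rightarrow> real" and \<alpha> :: "nat \<Rightarrow> real \<Rightarrow> real"
    and k_f k_b k_\<alpha> k_f\<alpha> K_f \<delta>0 s :: real
  defines "I \<equiv> {p 1..p N}"
    and "a \<equiv> min_slope N p"
    and "M \<equiv> fractal_bound N p f b \<alpha>"
  assumes "N \<ge> 3" and "strict_mono_on {1..N} p"
    and "continuous_on I f"
    and "continuous_on I b" and "b (p 1) = f (p 1)" and "b (p N) = f (p N)"
    and "\<exists>t\<in>I. b t \<noteq> f t"
    and "\<And>j. j \<in> {1..N - 1} \<Longrightarrow> continuous_on I (\<alpha> j)"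
    and "scaling_sup_norm N p \<alpha> < 1"
    and "is_fractal_function N p f b \<alpha> f\<alpha>"
    and "0 < s" and "s \<le> 1"
    and "k_f > 0" and "holder_on I s k_f f"
    and "k_b > 0" and "holder_on I s k_b b"
    and "k_\<alpha> > 0" and "\<And>j. j \<in> {1..N - 1} \<Longrightarrow> holder_on I s k_\<alpha> (\<alpha> j)"
    and "K_f > 0" and "\<delta>0 > 0" and "oscillates_on I s K_f \<delta>0 f"
    and "k_f\<alpha> > 0" and "holder_on I s k_f\<alpha> f\<alpha>"
    and "scaling_holder_norm N p s \<alpha> <
           a powr s * min 1 ((K_f - (sup_norm I b + M) * k_\<alpha> * a powr (- s)) / (k_f\<alpha> + k_b))"
  shows "has_box_dim (graph_on I f\<alpha>) (2 - s)"
proof -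
  note mono = assms(5) and cf = assms(6)[unfolded I_def] and cb = assms(7)[unfolded I_def]
    and c\<alpha> = assms(11)[unfolded I_def] and A1 = assms(12) and fractal = assms(13)
    and s = assms(14,15) and hb = assms(19)[unfolded I_def] and h\<alpha> = assms(21)[unfolded I_def]
    and osc = assms(24)[unfolded I_def] and hg = assms(26)[unfolded I_def]
    and norm_bound = assms(27)
  have kpos: "0 < k_b" "0 < k_\<alpha>" "0 < k_f\<alpha>" using assms by auto
  have N: "2 \<le> N" "1 \<in> {1..N - 1}" using \<open>N \<ge> 3\<close> by auto
  have p12: "p 1 < p 2" and p1N: "p 1 < p N"
    using \<open>N \<ge> 3\<close> by (auto intro!: strict_mono_onD[OF mono])
  have first: "{p 1..p 2} \<subseteq> I" using piece_subset[OF mono N(2)] by (simp add: I_def numeral_2_eq_2)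
  have cg: "continuous_on I f\<alpha>" using fractal by (simp add: is_fractal_function_def I_def)
  have a: "0 < a" "a \<le> piece_slope N p 1"
    using N piece_slope_pos[OF mono] by (auto simp: a_def min_slope_def)
  let ?A = "scaling_sup_norm N p \<alpha>" and ?R = "sup_norm I b + M"
  have A: "\<bar>\<alpha> 1 u\<bar> \<le> ?A" if "u \<in> {p 1..p N}" for u
    using abs_scaling_le[OF N(2)] c\<alpha> N(2) that by blast
  have R: "\<bar>f\<alpha> u - b u\<bar> \<le> ?R" if "u \<in> {p 1..p N}" for u
    using abs_fractal_function_le[OF N(1) mono fractal cf cb c\<alpha> A1 that] abs_le_sup_norm[OF cb that]
    unfolding M_def I_def by linarith
  define K where "K = K_f - (?A * (k_f\<alpha> + k_b) + ?R * k_\<alpha>) * a powr (- s)"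
  \<comment> \<open>Positivity of \<open>K\<close> is the bound on the Holder norm by the quotient under \<open>min\<close>, cleared of
    its denominator.\<close>
  have "0 < K"
  proof -
    let ?q = "(K_f - ?R * k_\<alpha> * a powr (- s)) / (k_f\<alpha> + k_b)"
    have "?A \<le> scaling_holder_norm N p s \<alpha>"
      using scaling_seminorm_nonneg[of N p s k_\<alpha> \<alpha>] N p1N h\<alpha>
      by (simp add: scaling_holder_norm_def)
    also have "\<dots> < a powr s * min 1 ?q" using norm_bound .
    also have "\<dots> \<le> a powr s * ?q" by (intro mult_left_mono) auto
    finally have "?A * a powr (- s) < ?q"
      using a(1) by (simp add: powr_minus_divide field_simps)
    then have "?A * a powr (- s) * (k_f\<alpha> + k_b) < K_f - ?R * k_\<alpha> * a powr (- s)"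
      using kpos by (simp add: pos_less_divide_eq)
    then show ?thesis by (simp add: K_def algebra_simps)
  qed
  \<comment> \<open>\<open>c\<close> and \<open>C\<close> are the constants of the lower and upper covering estimates; for \<open>\<delta> < \<epsilon>\<close>
    both estimates and the oscillation hypothesis apply.\<close>
  define c where "c = (p 2 - p 1) * K / 16"
  define C where "C = (2 * (p N - p 1) + 2) * (4 * k_f\<alpha> + 2)"
  define \<epsilon> where "\<epsilon> = min (min 1 \<delta>0) ((p 2 - p 1) / 8)"
  have "0 < \<epsilon>" using \<open>\<delta>0 > 0\<close> p12 by (simp add: \<epsilon>_def)
  have bounds: "c * \<delta> powr (- (2 - s)) \<le> real (covering_number (graph_on I f\<alpha>) \<delta>) \<and>
      real (covering_number (graph_on I f\<alpha>) \<delta>) \<le> C * \<delta> powr (- (2 - s))"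
    if \<delta>_pos: "0 < \<delta>" and \<delta>\<epsilon>: "\<delta> < \<epsilon>" for \<delta>
  proof -
    have \<delta>: "\<delta> < 1" "\<delta> < \<delta>0" "8 * \<delta> \<le> p 2 - p 1" using \<delta>\<epsilon> by (auto simp: \<epsilon>_def)
    have holder: "p 1 \<le> p N" "0 \<le> k_f\<alpha>" using p1N kpos by auto
    obtain D where D: "finite D" "graph_on I f\<alpha> \<subseteq> \<Union>D"
        "\<forall>U\<in>D. bounded U \<and> diameter U \<le> \<delta>"
      unfolding I_def by (rule holder_graph_cover[OF holder(1) hg holder(2) s \<delta>_pos \<delta>(1)])
    have "c * \<delta> powr (s - 2) \<le> real (covering_number (graph_on I f\<alpha>) \<delta>)"
      unfolding c_def
    proof (rule oscillating_covering_number_ge[OF p12 _ \<open>0 < K\<close> \<delta>_pos \<delta>(3) _ _ D])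
      show "continuous_on {p 1..p 2} f\<alpha>" using cg first continuous_on_subset by blast
      show "graph_on {p 1..p 2} f\<alpha> \<subseteq> graph_on I f\<alpha>" using first by (auto simp: graph_on_def)
      fix t assume t: "p 1 + \<delta> \<le> t" "t \<le> p 2 - \<delta>"
      show "\<exists>u. \<bar>t - u\<bar> \<le> \<delta> \<and> K * \<delta> powr s \<le> \<bar>f\<alpha> t - f\<alpha> u\<bar>"
        unfolding K_def
        using fractal_function_oscillation[OF mono fractal N(2) s(1) _ _ _ hb hg h\<alpha>[OF N(2)] A R a
            osc \<delta>_pos \<delta>(2)] t kpos
        by (simp add: numeral_2_eq_2)
    qed
    moreover have "real (covering_number (graph_on I f\<alpha>) \<delta>) \<le> C * \<delta> powr (s - 2)"
      unfolding C_def I_def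
      by (rule holder_covering_number_le[OF holder(1) hg holder(2) s \<delta>_pos \<delta>(1)])
    ultimately show ?thesis by simp
  qed
  show ?thesis
  proof (rule has_box_dim_if_covering_number_bounds)
    show "0 < c" using p12 \<open>0 < K\<close> by (simp add: c_def)
    show "0 < C" using p1N kpos by (simp add: C_def)
    show "\<forall>\<^sub>F \<delta> in at_right 0. c * \<delta> powr (- (2 - s)) \<le> real (covering_number (graph_on I f\<alpha>) \<delta>) \<and>
        real (covering_number (graph_on I f\<alpha>) \<delta>) \<le> C * \<delta> powr (- (2 - s))"
      unfolding eventually_at_right_field using bounds \<open>0 < \<epsilon>\<close> by blast
  qed
qed

end
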